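(* For all integers $n\ge2$, $\mathsf{BExc}_n^{+}(s,t)=\mathsf{DExc}_n(s,t)$ and $\mathsf{BExc}_n^{-}(s,t)=\mathsf{(B\text{-}D)Exc}_n(s,t)$. Hence, for every even $n$, $\mathsf{DExc}_n(s,t)$ and $\mathsf{(B\text{-}D)Exc}_n(s,t)$ are gamma positive with the same center of symmetry $n/2$; and for every odd $n\ge3$, each of the univariate polynomials $\mathsf{DExc}_n(t)$ and $\mathsf{(B\text{-}D)Exc}_n(t)$ can be written as a sum of two gamma positive polynomials.
   Context: $\mathfrak{B}_n$ is the group of signed permutations of $\{\pm1,\dots,\pm n\}$ ($\pi(-i)=-\pi(i)$), $\pi_i=\pi(i)$. $\mathfrak{D}_n\subseteq\mathfrak{B}_n$ consists of those $\pi$ with an even number of $i\in[n]$ such that $\pi_i<0$. $\mathsf{inv}_B(\pi)=|\{1\le i<j\le n:\pi_i>\pi_j\}|+\sum_{i:\pi_i<0}|\pi_i|$; $\mathfrak{B}_n^{+}$ is the set of $\pi\in\mathfrak{B}_n$ with $\mathsf{inv}_B(\pi)$ even, $\mathfrak{B}_n^{-}=\mathfrak{B}_n\setminus\mathfrak{B}_n^{+}$. The excedance statistic is $\mathsf{exc}_B(\pi)=\mathsf{exc}_D(\pi)=|\{i\in[n]:\pi(|\pi(i)|)>\pi(i)\}|+|\{i\in[n]:\pi_i=-i\}|$, with $\mathsf{nexc}=n-\mathsf{exc}$. Define $\mathsf{BExc}_n^{\pm}(s,t)=\sum_{\pi\in\mathfrak{B}_n^{\pm}}t^{\mathsf{exc}_B(\pi)}s^{\mathsf{nexc}_B(\pi)}$,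 $\mathsf{DExc}_n(s,t)=\sum_{\pi\in\mathfrak{D}_n}t^{\mathsf{exc}_D(\pi)}s^{\mathsf{nexc}_D(\pi)}$, $\mathsf{(B\text{-}D)Exc}_n(s,t)=\sum_{\pi\in\mathfrak{B}_n\setminus\mathfrak{D}_n}t^{\mathsf{exc}_D(\pi)}s^{\mathsf{nexc}_D(\pi)}$, and $\mathsf{DExc}_n(t),\mathsf{(B\text{-}D)Exc}_n(t)$ their specializations at $s=1$. A homogeneous $f(s,t)$ of degree $d$ is gamma positive with center $d/2$ if $f=\sum_{i=0}^{\lfloor d/2\rfloor}\gamma_i(st)^i(s+t)^{d-2i}$ with $\gamma_i\ge0$. A univariate $f(t)=\sum_{i=0}^Na_it^i$ ($a_N\ne0$, $r$ least with $a_r\ne0$) is gamma positive if $f(t)=\sum_{i=0}^{\lfloor(N-r)/2\rfloor}\gamma_i t^{r+i}(1+t)^{N-r-2i}$ with $\gamma_i\ge0$ (its center of symmetry is $(N+r)/2$). *)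

theory Defs
  imports
    "HOL-Combinatorics.Permutations"
    "HOL-Computational_Algebra.Polynomial"
    Complex_Main
begin

definition signed_perms :: "nat \<Rightarrow> (int \<Rightarrow> int) set" where
  "signed_perms n =
     {\<pi>. \<pi> permutes ({- int n..int n} - {0}) \<and> (\<forall>i. \<pi> (- i) = - \<pi> i)}"

definition even_signed_perms :: "nat \<Rightarrow> (int \<Rightarrow> int) set" where
  "even_signed_perms n = {\<pi> \<in> signed_perms n. even (card {i \<in> {1..int n}. \<pi> i < 0})}"

definition inv_B :: "nat \<Rightarrow> (int \<Rightarrow> int) \<Rightarrow> nat" where
  "inv_B n \<pi> =
     card {(i, j). 1 \<le> i \<and> i < j \<and> j \<le> int n \<and> \<pi> i > \<pi> j}
     + (\<Sum>i \<in> {i \<in> {1..int n}. \<pi> i < 0}. nat \<bar>\<pi> i\<bar>)"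

definition B_plus :: "nat \<Rightarrow> (int \<Rightarrow> int) set" where
  "B_plus n = {\<pi> \<in> signed_perms n. even (inv_B n \<pi>)}"

definition B_minus :: "nat \<Rightarrow> (int \<Rightarrow> int) set" where
  "B_minus n = signed_perms n - B_plus n"

definition exc :: "nat \<Rightarrow> (int \<Rightarrow> int) \<Rightarrow> nat" where
  "exc n \<pi> =
     card {i \<in> {1..int n}. \<pi> \<bar>\<pi> i\<bar> > \<pi> i} + card {i \<in> {1..int n}. \<pi> i = - i}"

text \<open>The two sets counted by \<^const>\<open>exc\<close> are disjoint for a signed permutation, so
  the subtraction below does not truncate.\<close>

definition nexc :: "nat \<Rightarrow> (int \<Rightarrow> int) \<Rightarrow> nat" where
  "nexc n \<pi> = n - exc n \<pi>"

text \<open>A polynomial in \<open>s\<close> and \<open>t\<close> is a polynomial in \<open>s\<close> whose coefficients are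
  polynomials in \<open>t\<close>. The specialization of \<open>F\<close> at \<open>s = 1\<close> is thus \<open>poly F 1\<close>.\<close>

definition var_s :: "real poly poly" where
  "var_s = [:0, 1:]"

definition var_t :: "real poly poly" where
  "var_t = [:[:0, 1:]:]"

definition exc_poly :: "nat \<Rightarrow> (int \<Rightarrow> int) set \<Rightarrow> real poly poly" where
  "exc_poly n A = (\<Sum>\<pi>\<in>A. var_t ^ exc n \<pi> * var_s ^ nexc n \<pi>)"

definition BExc_plus :: "nat \<Rightarrow> real poly poly" where
  "BExc_plus n = exc_poly n (B_plus n)"

definition BExc_minus :: "nat \<Rightarrow> real poly poly" where
  "BExc_minus n = exc_poly n (B_minus n)"

definition DExc :: "nat \<Rightarrow> real poly poly" where
  "DExc n = exc_poly n (even_signed_perms n)"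

definition BDExc :: "nat \<Rightarrow> real poly poly" where
  "BDExc n = exc_poly n (signed_perms n - even_signed_perms n)"

definition DExc_uni :: "nat \<Rightarrow> real poly" where
  "DExc_uni n = poly (DExc n) 1"

definition BDExc_uni :: "nat \<Rightarrow> real poly" where
  "BDExc_uni n = poly (BDExc n) 1"

definition homogeneous :: "nat \<Rightarrow> real poly poly \<Rightarrow> bool" where
  "homogeneous d F \<longleftrightarrow> (\<forall>i j. coeff (coeff F i) j \<noteq> 0 \<longrightarrow> i + j = d)"

text \<open>Nonzeroness makes the degree \<open>d\<close>, and hence the center \<open>d / 2\<close>, unique.\<close>

definition gamma_positive_biv :: "real poly poly \<Rightarrow> real \<Rightarrow> bool" where
  "gamma_positive_biv F c \<longleftrightarrow>
     F \<noteq> 0 \<and>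
     (\<exists>d. c = real d / 2 \<and> homogeneous d F \<and>
       (\<exists>\<gamma> :: nat \<Rightarrow> real. (\<forall>i \<le> d div 2. \<gamma> i \<ge> 0) \<and>
         F = (\<Sum>i \<le> d div 2.
               [:[:\<gamma> i:]:] * (var_s * var_t) ^ i * (var_s + var_t) ^ (d - 2 * i))))"

definition low_degree :: "real poly \<Rightarrow> nat" where
  "low_degree f = (LEAST r. coeff f r \<noteq> 0)"

definition gamma_positive :: "real poly \<Rightarrow> bool" where
  "gamma_positive f \<longleftrightarrow>
     f \<noteq> 0 \<and>
     (\<exists>\<gamma> :: nat \<Rightarrow> real. (\<forall>i \<le> (degree f - low_degree f) div 2. \<gamma> i \<ge> 0) \<and>
       f = (\<Sum>i \<le> (degree f - low_degree f) div 2.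
             smult (\<gamma> i) ([:0, 1:] ^ (low_degree f + i)
                           * [:1, 1:] ^ (degree f - low_degree f - 2 * i))))"

end

theory Submission imports Defs begin

text \<open>Removing the largest letter \<open>\<plusminus>n\<close> from the cycle notation shows that the sum of
  \<open>\<chi>(\<pi>) t\<^bsup>exc\<^esup> s\<^bsup>nexc\<^esup>\<close> over all signed permutations is \<open>(s - t)\<^sup>n\<close> for both
  \<open>\<chi> = (- 1)\<^bsup>neg\<^esup>\<close> and \<open>\<chi> = (- 1)\<^bsup>inv\<^esup>\<close>: changing the sign of \<open>n\<close> flips \<open>\<chi>\<close> and, unless \<open>n\<close>
  is fixed up to sign, keeps the excedance number. So with \<open>T\<close> the sum for \<open>\<chi> = 1\<close>, the
  polynomials in question are \<open>(T \<plusminus> (s - t)\<^sup>n) / 2\<close>. The same removal gives the Eulerian recurrence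
  of type B for \<open>T\<close>, whose gamma coefficients \<open>4\<^sup>i L(n, i)\<close> satisfy \<open>L(n, i) \<ge> (n div 2 choose i)\<close>;
  they therefore dominate those of \<open>((s + t)\<^sup>2 - 4 s t)\<^sup>m = (s - t)\<^bsup>2m\<^esup>\<close>, where \<open>m = n div 2\<close>.
  For odd \<open>n\<close> write \<open>T = (s + t) G\<close> and \<open>(s - t)\<^sup>n = (s - t) H\<close>; then
  \<open>T + (s - t)\<^sup>n = s (G + H) + t (G - H)\<close> and \<open>T - (s - t)\<^sup>n = s (G - H) + t (G + H)\<close>.\<close>

section \<open>Inserting the largest letter\<close>

lemma signed_perms_permutes: "\<pi> \<in> signed_perms n \<Longrightarrow> \<pi> permutes ({- int n..int n} - {0})"
  by (simp add: signed_perms_def)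

lemma signed_perms_minus: "\<pi> \<in> signed_perms n \<Longrightarrow> \<pi> (- i) = - \<pi> i"
  by (simp add: signed_perms_def)

lemma signed_perms_inj: "\<pi> \<in> signed_perms n \<Longrightarrow> \<pi> i = \<pi> j \<longleftrightarrow> i = j"
  by (meson permutes_inj signed_perms_permutes inj_eq)

lemma signed_perms_outside: "\<pi> \<in> signed_perms n \<Longrightarrow> \<bar>i\<bar> > int n \<Longrightarrow> \<pi> i = i"
  by (rule permutes_not_in[OF signed_perms_permutes]) auto

lemma signed_perms_range:
  assumes "\<pi> \<in> signed_perms n" "i \<in> {1..int n}"
  shows "\<pi> i \<noteq> 0" "\<bar>\<pi> i\<bar> \<in> {1..int n}"
proof -
  have "\<pi> i \<in> {- int n..int n} - {0}"
    using permutes_in_image[OF signed_perms_permutes[OF assms(1)], of i] assms(2) by auto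
  then show "\<pi> i \<noteq> 0" "\<bar>\<pi> i\<bar> \<in> {1..int n}" by auto
qed

lemma finite_signed_perms: "finite (signed_perms n)"
proof -
  have "finite {\<pi>. \<pi> permutes ({- int n..int n} - {0})}"
    by (rule finite_permutations) auto
  then show ?thesis by (rule rev_finite_subset) (auto simp: signed_perms_def)
qed

lemma id_in_signed_perms: "id \<in> signed_perms n"
  by (simp add: signed_perms_def permutes_id)

lemma signed_perms_0: "signed_perms 0 = {id}"
proof -
  have "{- int 0..int 0} - {0} = ({}::int set)" by auto
  then show ?thesis using id_in_signed_perms[of 0] by (auto simp: signed_perms_def)
qed

lemma signed_perms_comp:
  "\<pi> \<in> signed_perms n \<Longrightarrow> \<rho> \<in> signed_perms n \<Longrightarrow> \<pi> \<circ> \<rho> \<in> signed_perms n"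
  by (auto simp: signed_perms_def intro: permutes_compose)

text \<open>Elements of \<open>signed_perms n\<close> are functions on all integers that fix
  everything outside their range. The group for \<open>n\<close> is therefore literally the
  stabilizer of \<open>n + 1\<close> in the next group, and the inductions need no
  embedding.\<close>

lemma signed_perms_Suc_iff:
  "\<pi> \<in> signed_perms n \<longleftrightarrow> \<pi> \<in> signed_perms (Suc n) \<and> \<pi> (int (Suc n)) = int (Suc n)"
proof (safe)
  assume a: "\<pi> \<in> signed_perms n"
  show "\<pi> \<in> signed_perms (Suc n)"
    using a by (auto simp: signed_perms_def intro: permutes_subset)
  show "\<pi> (int (Suc n)) = int (Suc n)"
    using signed_perms_outside[OF a] by simp
next
  assume a: "\<pi> \<in> signed_perms (Suc n)" and N: "\<pi> (int (Suc n)) = int (Suc n)"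
  have "\<pi> permutes ({- int n..int n} - {0})"
  proof (rule permutes_superset[OF signed_perms_permutes[OF a]])
    fix x assume "x \<in> ({- int (Suc n)..int (Suc n)} - {0}) - ({- int n..int n} - {0})"
    then have "x = int (Suc n) \<or> x = - int (Suc n)" by auto
    then show "\<pi> x = x" using N signed_perms_minus[OF a, of "int (Suc n)"] by auto
  qed
  then show "\<pi> \<in> signed_perms n" using a by (simp add: signed_perms_def)
qed

text \<open>Equal moduli force \<open>\<pi> i = \<pi> j\<close> or
  \<open>\<pi> i = \<pi> (- j)\<close>; the second is impossible for positive \<open>i\<close> and
  \<open>j\<close>. Surjectivity follows by finiteness.\<close>

lemma bij_betw_abs_signed_perm:
  assumes "\<pi> \<in> signed_perms n"
  shows "bij_betw (\<lambda>i. \<bar>\<pi> i\<bar>) {1..int n} {1..int n}"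
proof -
  have inj: "inj_on (\<lambda>i. \<bar>\<pi> i\<bar>) {1..int n}"
  proof (rule inj_onI)
    fix i j assume ij: "i \<in> {1..int n}" "j \<in> {1..int n}" "\<bar>\<pi> i\<bar> = \<bar>\<pi> j\<bar>"
    then have "\<pi> i = \<pi> j \<or> \<pi> i = \<pi> (- j)"
      using signed_perms_minus[OF assms] by (auto simp: abs_eq_iff)
    then show "i = j" using ij signed_perms_inj[OF assms] by auto
  qed
  moreover have "(\<lambda>i. \<bar>\<pi> i\<bar>) ` {1..int n} = {1..int n}"
    using signed_perms_range[OF assms] by (intro endo_inj_surj[OF _ _ inj]) auto
  ultimately show ?thesis by (simp add: bij_betw_def)
qed

section \<open>Insertion of a letter as a composition with involutions\<close>

definition sign_flip :: "nat \<Rightarrow> int \<Rightarrow> int" where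
  "sign_flip n x = (if \<bar>x\<bar> = int n then - x else x)"

text \<open>This is the transposition of \<open>p\<close> and \<open>n\<close> together with its
  mirror image. At \<open>p = n\<close> it degenerates to the identity, so opening a new cycle is
  not a separate case of insertion.\<close>

definition signed_swap :: "int \<Rightarrow> nat \<Rightarrow> int \<Rightarrow> int" where
  "signed_swap p n x =
     (if x = p then int n else if x = int n then p
      else if x = - p then - int n else if x = - int n then - p else x)"

lemma sign_flip_invol [simp]: "sign_flip n (sign_flip n x) = x"
  by (simp add: sign_flip_def)

lemma signed_swap_invol [simp]: "p > 0 \<Longrightarrow> n > 0 \<Longrightarrow> signed_swap p n (signed_swap p n x) = x"
  by (auto simp: signed_swap_def)

lemma involution_in_signed_perms:
  assumes "\<And>x. f (f x) = x" "\<And>x. f (- x) = - f x" "\<And>x. \<bar>x\<bar> > int n \<Longrightarrow> f x = x"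
  shows "f \<in> signed_perms n"
proof -
  have "bij f" by (rule involuntory_imp_bij) (rule assms(1))
  moreover have "f 0 = 0" using assms(2)[of 0] by simp
  then have "f x = x" if "x \<notin> {- int n..int n} - {0}" for x
    using assms(3)[of x] that by (cases "x = 0") auto
  ultimately have "f permutes ({- int n..int n} - {0})"
    unfolding permutes_def bij_iff by blast
  then show ?thesis using assms(2) by (simp add: signed_perms_def)
qed

lemma sign_flip_in_signed_perms: "n > 0 \<Longrightarrow> sign_flip n \<in> signed_perms n"
  by (rule involution_in_signed_perms) (auto simp: sign_flip_def)

lemma signed_swap_in_signed_perms:
  "p \<in> {1..int n} \<Longrightarrow> signed_swap p n \<in> signed_perms n"
  by (rule involution_in_signed_perms) (auto simp: signed_swap_def)

text \<open>Inserts the letter \<open>\<plusminus>(n + 1)\<close>, with sign given by \<open>e\<close>, just after \<open>p\<close> in the cycle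
  notation, or as a new cycle when \<open>p = n + 1\<close>.\<close>

definition insert_letter :: "nat \<Rightarrow> bool \<Rightarrow> int \<Rightarrow> (int \<Rightarrow> int) \<Rightarrow> int \<Rightarrow> int" where
  "insert_letter n e p \<pi> =
     (if e then id else sign_flip (Suc n)) \<circ> (\<pi> \<circ> signed_swap p (Suc n))"

lemma insert_letter_in_signed_perms:
  assumes "\<pi> \<in> signed_perms n" "p \<in> {1..int (Suc n)}"
  shows "insert_letter n e p \<pi> \<in> signed_perms (Suc n)"
  using assms signed_perms_Suc_iff[of \<pi> n]
  by (auto simp: insert_letter_def del: o_apply intro!: signed_perms_comp
      sign_flip_in_signed_perms signed_swap_in_signed_perms id_in_signed_perms)

text \<open>The swap on the right reroutes the arc from \<open>p\<close> to \<open>\<pi> p\<close>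
  through \<open>n + 1\<close>. The flip on the left touches only the values of modulus
  \<open>n + 1\<close>, and in the window this modulus is attained only at \<open>p\<close>.\<close>

lemma insert_letter_apply:
  assumes "\<pi> \<in> signed_perms n" "p \<in> {1..int (Suc n)}" "i \<in> {1..int (Suc n)}"
  shows "insert_letter n e p \<pi> i =
    (if i = p then (if e then int (Suc n) else - int (Suc n))
     else if i = int (Suc n) then \<pi> p else \<pi> i)"
proof -
  have N: "\<pi> (int (Suc n)) = int (Suc n)" using assms(1) signed_perms_Suc_iff by blast
  have lt: "\<bar>\<pi> j\<bar> < int (Suc n)" if "j \<in> {1..int n}" for j
    using signed_perms_range(2)[OF assms(1) that] by simp
  consider "i = p" | "i \<noteq> p" "i = int (Suc n)" | "i \<noteq> p" "i \<noteq> int (Suc n)" by blast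
  then show ?thesis
  proof cases
    case 1
    then show ?thesis using N by (simp add: insert_letter_def signed_swap_def sign_flip_def)
  next
    case 2
    then have "p \<in> {1..int n}" using assms by auto
    with 2 show ?thesis using lt[of p] 
      by (simp add: insert_letter_def signed_swap_def sign_flip_def)
  next
    case 3
    then have "i \<in> {1..int n}" "i \<noteq> - p" "i \<noteq> - int (Suc n)" using assms by auto
    with 3 show ?thesis using lt[of i]
      by (simp add: insert_letter_def signed_swap_def sign_flip_def)
  qed
qed

text \<open>The inverse reads off \<open>p\<close> as the position of the letter of modulus
  \<open>n + 1\<close> and \<open>e\<close> as its sign. Then \<open>\<pi>\<close> is recovered
  because both composed factors are involutions.\<close>

lemma bij_betw_insert_letter:
  "bij_betw (\<lambda>(e, p, \<pi>). insert_letter n e p \<pi>)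
     (UNIV \<times> {1..int (Suc n)} \<times> signed_perms n) (signed_perms (Suc n))"
proof -
  define N where "N = int (Suc n)"
  have inj: "e = e' \<and> p = p' \<and> \<pi> = \<pi>'"
    if "p \<in> {1..N}" "\<pi> \<in> signed_perms n" "p' \<in> {1..N}" "\<pi>' \<in> signed_perms n"
      and eq: "insert_letter n e p \<pi> = insert_letter n e' p' \<pi>'" for e p \<pi> e' p' \<pi>'
  proof -
    have at_p: "insert_letter n e p \<pi> p = (if e then N else - N)"
      using insert_letter_apply[OF that(2), of p p e] that by (simp add: N_def)
    have at_p': "insert_letter n e' p' \<pi>' p' = (if e' then N else - N)"
      using insert_letter_apply[OF that(4), of p' p' e'] that by (simp add: N_def)
    have mem: "insert_letter n e p \<pi> \<in> signed_perms (Suc n)"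
      using insert_letter_in_signed_perms that by (simp add: N_def)
    have "inj_on (\<lambda>i. \<bar>insert_letter n e p \<pi> i\<bar>) {1..N}"
      using bij_betw_abs_signed_perm[OF mem] by (simp add: bij_betw_def N_def)
    moreover have "\<bar>insert_letter n e p \<pi> p\<bar> = \<bar>insert_letter n e p \<pi> p'\<bar>"
      using at_p at_p' eq by (simp split: if_splits)
    ultimately have p: "p = p'" using that by (auto dest: inj_onD)
    have e: "e = e'" using at_p at_p' eq p by (simp add: N_def split: if_splits)
    have "\<pi> x = \<pi>' x" for x
    proof -
      have "insert_letter n e p \<pi> (signed_swap p (Suc n) x) =
        insert_letter n e p \<pi>' (signed_swap p (Suc n) x)" using eq p e by simp
      then have "(if e then id else sign_flip (Suc n)) (\<pi> x) =
        (if e then id else sign_flip (Suc n)) (\<pi>' x)"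
        using that(1) by (simp add: insert_letter_def)
      then show ?thesis by (metis id_apply sign_flip_invol)
    qed
    with p e show ?thesis by auto
  qed
  have surj: "\<exists>e p \<pi>. p \<in> {1..N} \<and> \<pi> \<in> signed_perms n \<and> \<rho> = insert_letter n e p \<pi>"
    if \<rho>: "\<rho> \<in> signed_perms (Suc n)" for \<rho>
  proof -
    have "N \<in> (\<lambda>i. \<bar>\<rho> i\<bar>) ` {1..N}"
      using bij_betw_abs_signed_perm[OF \<rho>] by (simp add: bij_betw_def N_def)
    then obtain p where p: "p \<in> {1..N}" "\<bar>\<rho> p\<bar> = N" by auto
    define e where "e \<longleftrightarrow> \<rho> p = N"
    define f where "f = (if e then id else sign_flip (Suc n))"
    define \<pi> where "\<pi> = f \<circ> (\<rho> \<circ> signed_swap p (Suc n))"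
    have f: "f \<in> signed_perms (Suc n)" "f (f x) = x" for x
      using id_in_signed_perms sign_flip_in_signed_perms by (auto simp: f_def)
    have "\<pi> \<in> signed_perms (Suc n)"
      unfolding \<pi>_def using p \<rho> f
      by (intro signed_perms_comp signed_swap_in_signed_perms) (auto simp: N_def)
    moreover have "\<pi> (int (Suc n)) = int (Suc n)"
      using p by (auto simp: \<pi>_def signed_swap_def f_def e_def sign_flip_def N_def)
    ultimately have "\<pi> \<in> signed_perms n" using signed_perms_Suc_iff by blast
    moreover have "\<rho> = insert_letter n e p \<pi>"
      using p(1) f(2) by (auto simp: insert_letter_def \<pi>_def f_def[symmetric])
    ultimately show ?thesis using p by blast
  qed
  show ?thesis
    unfolding bij_betw_def
  proof
    show "inj_on (\<lambda>(e, p, \<pi>). insert_letter n e p \<pi>) (UNIV \<times> {1..int (Suc n)} \<times> signed_perms n)"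
      using inj by (auto simp: inj_on_def N_def)
    show "(\<lambda>(e, p, \<pi>). insert_letter n e p \<pi>) ` (UNIV \<times> {1..int (Suc n)} \<times> signed_perms n) =
      signed_perms (Suc n)"
    proof (rule set_eqI, rule iffI)
      fix \<rho> assume "\<rho> \<in> signed_perms (Suc n)"
      from surj[OF this] obtain e p \<pi>
        where "p \<in> {1..N}" "\<pi> \<in> signed_perms n" "\<rho> = insert_letter n e p \<pi>" by blast
      then show "\<rho> \<in> (\<lambda>(e, p, \<pi>). insert_letter n e p \<pi>) `
          (UNIV \<times> {1..int (Suc n)} \<times> signed_perms n)"
        by (intro image_eqI[of _ _ "(e, p, \<pi>)"]) (auto simp: N_def)
    qed (auto intro: insert_letter_in_signed_perms)
  qed
qed

lemma sum_signed_perms_Suc: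
  "(\<Sum>\<rho>\<in>signed_perms (Suc n). f \<rho>) =
   (\<Sum>\<pi>\<in>signed_perms n. \<Sum>p\<in>{1..int (Suc n)}.
      f (insert_letter n True p \<pi>) + f (insert_letter n False p \<pi>))"
proof -
  have "(\<Sum>\<rho>\<in>signed_perms (Suc n). f \<rho>) =
    (\<Sum>(e, p, \<pi>)\<in>UNIV \<times> {1..int (Suc n)} \<times> signed_perms n. f (insert_letter n e p \<pi>))"
    by (subst sum.reindex_bij_betw[OF bij_betw_insert_letter, symmetric])
      (simp add: case_prod_unfold)
  also have "\<dots> = (\<Sum>e\<in>UNIV. \<Sum>p\<in>{1..int (Suc n)}. \<Sum>\<pi>\<in>signed_perms n. f (insert_letter n e p \<pi>))"
    by (simp only: sum.cartesian_product)
  also have "\<dots> = (\<Sum>p\<in>{1..int (Suc n)}. \<Sum>\<pi>\<in>signed_perms n.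
      f (insert_letter n True p \<pi>) + f (insert_letter n False p \<pi>))"
    by (simp add: UNIV_bool sum.distrib add.commute)
  also have "\<dots> = (\<Sum>\<pi>\<in>signed_perms n. \<Sum>p\<in>{1..int (Suc n)}.
      f (insert_letter n True p \<pi>) + f (insert_letter n False p \<pi>))"
    by (rule sum.swap)
  finally show ?thesis .
qed

section \<open>The excedance statistic\<close>

text \<open>Excedances are indexed by letters instead of positions: \<open>j\<close>, with the sign it carries in
  the window of \<open>\<pi>\<close>, is compared with its successor \<open>\<pi> j\<close>.\<close>

definition exc_arc :: "nat \<Rightarrow> (int \<Rightarrow> int) \<Rightarrow> int \<Rightarrow> bool" where
  "exc_arc n \<pi> j \<longleftrightarrow> \<pi> j > (if j \<in> \<pi> ` {1..int n} then j else - j) \<or> \<pi> j = - j"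

text \<open>Reindex the first set in \<open>exc\<close> along
  \<open>j = \<bar>\<pi> i\<bar>\<close>. Exactly one of \<open>j\<close> and \<open>- j\<close>
  occurs in the window, and it is \<open>\<pi> i\<close>. The second set is already indexed by
  \<open>j\<close>; it is disjoint from the first because \<open>\<pi> j = - j\<close> makes the
  comparison an equality.\<close>

lemma exc_eq_card_arc:
  assumes \<pi>: "\<pi> \<in> signed_perms n"
  shows "exc n \<pi> = card {j \<in> {1..int n}. exc_arc n \<pi> j}"
proof -
  let ?c = "\<lambda>j. if j \<in> \<pi> ` {1..int n} then j else - j"
  have neg: "- \<pi> i \<notin> \<pi> ` {1..int n}" if "i \<in> {1..int n}" for i
  proof
    assume "- \<pi> i \<in> \<pi> ` {1..int n}"
    then obtain j where "j \<in> {1..int n}" "\<pi> (- i) = \<pi> j"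
      using signed_perms_minus[OF \<pi>] by auto
    then show False using that signed_perms_inj[OF \<pi>, of "- i" j] by auto
  qed
  have c: "?c \<bar>\<pi> i\<bar> = \<pi> i" if "i \<in> {1..int n}" for i
    using that neg[OF that] by (cases "\<pi> i > 0") (auto simp: abs_if)
  have bij: "bij_betw (\<lambda>i. \<bar>\<pi> i\<bar>) {i \<in> {1..int n}. \<pi> \<bar>\<pi> i\<bar> > \<pi> i}
      {j \<in> {1..int n}. \<pi> j > ?c j}"
    unfolding bij_betw_def
  proof
    show "inj_on (\<lambda>i. \<bar>\<pi> i\<bar>) {i \<in> {1..int n}. \<pi> \<bar>\<pi> i\<bar> > \<pi> i}"
      using bij_betw_abs_signed_perm[OF \<pi>] unfolding bij_betw_def
      by (auto intro: inj_on_subset)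
    have "j \<in> (\<lambda>i. \<bar>\<pi> i\<bar>) ` {i \<in> {1..int n}. \<pi> \<bar>\<pi> i\<bar> > \<pi> i}"
      if j: "j \<in> {1..int n}" "\<pi> j > ?c j" for j
    proof -
      have "j \<in> (\<lambda>i. \<bar>\<pi> i\<bar>) ` {1..int n}"
        using bij_betw_abs_signed_perm[OF \<pi>] j unfolding bij_betw_def by simp
      then obtain i where "i \<in> {1..int n}" "j = \<bar>\<pi> i\<bar>" by blast
      then show ?thesis using c[of i] j by auto
    qed
    moreover have "\<bar>\<pi> i\<bar> \<in> {j \<in> {1..int n}. \<pi> j > ?c j}"
      if "i \<in> {1..int n}" "\<pi> \<bar>\<pi> i\<bar> > \<pi> i" for i
      using that c[of i] signed_perms_range(2)[OF \<pi> that(1)] by simp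
    ultimately show "(\<lambda>i. \<bar>\<pi> i\<bar>) ` {i \<in> {1..int n}. \<pi> \<bar>\<pi> i\<bar> > \<pi> i} =
      {j \<in> {1..int n}. \<pi> j > ?c j}" by blast
  qed
  have fin: "finite {j \<in> {1..int n}. P j}" for P
    by (rule finite_subset[of _ "{1..int n}"]) auto
  have disj: "\<not> \<pi> j > ?c j" if "j \<in> {1..int n}" "\<pi> j = - j" for j
    using neg[OF that(1)] that by auto
  have "exc n \<pi> = card {j \<in> {1..int n}. \<pi> j > ?c j} + card {j \<in> {1..int n}. \<pi> j = - j}"
    using bij_betw_same_card[OF bij] by (simp add: exc_def)
  also have "\<dots> = card ({j \<in> {1..int n}. \<pi> j > ?c j} \<union> {j \<in> {1..int n}. \<pi> j = - j})"
    by (intro card_Un_disjoint[symmetric] fin) (use disj in blast)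
  also have "{j \<in> {1..int n}. \<pi> j > ?c j} \<union> {j \<in> {1..int n}. \<pi> j = - j} =
      {j \<in> {1..int n}. exc_arc n \<pi> j}"
    by (auto simp: exc_arc_def)
  finally show ?thesis .
qed

lemma exc_eq_sum:
  "\<pi> \<in> signed_perms n \<Longrightarrow> exc n \<pi> = (\<Sum>j\<in>{1..int n}. of_bool (exc_arc n \<pi> j))"
  by (simp add: exc_eq_card_arc Int_def)

lemma exc_le: "\<pi> \<in> signed_perms n \<Longrightarrow> exc n \<pi> \<le> n"
  using card_mono[of "{1..int n}" "{j \<in> {1..int n}. exc_arc n \<pi> j}"]
  by (simp add: exc_eq_card_arc subset_iff)

lemma image_insert_letter:
  assumes "\<pi> \<in> signed_perms n" "p \<in> {1..int (Suc n)}"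
  shows "insert_letter n e p \<pi> ` {1..int (Suc n)} =
    insert (if e then int (Suc n) else - int (Suc n)) (\<pi> ` {1..int n})"
proof (rule set_eqI, rule iffI)
  fix x assume "x \<in> insert_letter n e p \<pi> ` {1..int (Suc n)}"
  then obtain i where i: "i \<in> {1..int (Suc n)}" "x = insert_letter n e p \<pi> i" by blast
  then show "x \<in> insert (if e then int (Suc n) else - int (Suc n)) (\<pi> ` {1..int n})"
    using insert_letter_apply[OF assms i(1), of e] assms(2) by (auto split: if_splits)
next
  fix x assume x: "x \<in> insert (if e then int (Suc n) else - int (Suc n)) (\<pi> ` {1..int n})"
  show "x \<in> insert_letter n e p \<pi> ` {1..int (Suc n)}"
  proof (cases "x \<in> \<pi> ` {1..int n}")
    case False
    then show ?thesis using x insert_letter_apply[OF assms assms(2), of e] assms(2)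
      by (metis image_eqI insertE)
  next
    case True
    then obtain i where i: "i \<in> {1..int n}" "x = \<pi> i" by blast
    show ?thesis
    proof (cases "i = p")
      case True
      then have "insert_letter n e p \<pi> (int (Suc n)) = x"
        using insert_letter_apply[OF assms, of "int (Suc n)" e] i by auto
      then show ?thesis by (intro image_eqI[of _ _ "int (Suc n)"]) auto
    next
      case False
      then have "insert_letter n e p \<pi> i = x"
        using insert_letter_apply[OF assms, of i e] i by auto
      then show ?thesis using i by (intro image_eqI[of _ _ i]) auto
    qed
  qed
qed

text \<open>The arc at \<open>p\<close> is replaced by one into the new letter and one out of it.
  The former is an excedance exactly for a positive letter, the latter exactly for a negative one.
  Together they add one whatever \<open>e\<close> is, so only the lost arc at \<open>p\<close>
  matters.\<close>

lemma exc_insert_letter: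
  assumes \<pi>: "\<pi> \<in> signed_perms n" and p: "p \<in> {1..int n}"
  shows "exc (Suc n) (insert_letter n e p \<pi>) =
    (if exc_arc n \<pi> p then exc n \<pi> else Suc (exc n \<pi>))"
proof -
  define N where "N = int (Suc n)"
  define \<rho> where "\<rho> = insert_letter n e p \<pi>"
  have pN: "p \<in> {1..int (Suc n)}" "p \<noteq> N" using p by (auto simp: N_def)
  have \<rho>: "\<rho> \<in> signed_perms (Suc n)"
    using insert_letter_in_signed_perms[OF \<pi> pN(1)] by (simp add: \<rho>_def)
  have range: "\<rho> ` {1..int (Suc n)} = insert (if e then N else - N) (\<pi> ` {1..int n})"
    using image_insert_letter[OF \<pi> pN(1)] by (simp add: \<rho>_def N_def)
  have app: "\<rho> i = (if i = p then (if e then N else - N) else if i = N then \<pi> p else \<pi> i)"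
    if "i \<in> {1..N}" for i
    using insert_letter_apply[OF \<pi> pN(1), of i e] that by (simp add: \<rho>_def N_def)
  have notin: "N \<notin> \<pi> ` {1..int n}"
    using signed_perms_range(2)[OF \<pi>] by (force simp: N_def)
  have other: "exc_arc (Suc n) \<rho> j = exc_arc n \<pi> j" if "j \<in> {1..int n}" "j \<noteq> p" for j
    using that app[of j] unfolding exc_arc_def range by (auto simp: N_def)
  have at_p: "exc_arc (Suc n) \<rho> p = e"
    using p app[of p] unfolding exc_arc_def range by (auto simp: N_def)
  have at_N: "exc_arc (Suc n) \<rho> N = (\<not> e)"
    using p app[of N] pN notin signed_perms_range[OF \<pi> p] unfolding exc_arc_def range
    by (auto simp: N_def)
  have split: "{1..int (Suc n)} = insert N (insert p ({1..int n} - {p}))"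
    using p by (auto simp: N_def)
  have N_notin: "N \<notin> {1..int n}" by (simp add: N_def)
  have "exc (Suc n) \<rho> = of_bool (\<not> e) + (of_bool e + (\<Sum>j\<in>{1..int n} - {p}. of_bool (exc_arc n \<pi> j)))"
    unfolding exc_eq_sum[OF \<rho>] split using pN at_p at_N other N_notin by (simp del: sum_of_bool_eq insert_Diff_single)
  moreover have "exc n \<pi> = of_bool (exc_arc n \<pi> p) + (\<Sum>j\<in>{1..int n} - {p}. of_bool (exc_arc n \<pi> j))"
    unfolding exc_eq_sum[OF \<pi>] by (rule sum.remove[OF _ p]) simp
  ultimately show ?thesis by (auto simp: \<rho>_def)
qed

text \<open>A positive new cycle is a fixed point and adds nothing; a negative one satisfies
  \<open>\<pi> j = - j\<close>, which counts as an excedance. Only for new cycles does the sign of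
  the letter affect the statistic.\<close>

lemma exc_insert_letter_top:
  assumes \<pi>: "\<pi> \<in> signed_perms n"
  shows "exc (Suc n) (insert_letter n e (int (Suc n)) \<pi>) =
    (if e then exc n \<pi> else Suc (exc n \<pi>))"
proof -
  define N where "N = int (Suc n)"
  define \<rho> where "\<rho> = insert_letter n e N \<pi>"
  have pN: "N \<in> {1..int (Suc n)}" by (auto simp: N_def)
  have \<rho>: "\<rho> \<in> signed_perms (Suc n)"
    using insert_letter_in_signed_perms[OF \<pi> pN] by (simp add: \<rho>_def)
  have range: "\<rho> ` {1..int (Suc n)} = insert (if e then N else - N) (\<pi> ` {1..int n})"
    using image_insert_letter[OF \<pi> pN] by (simp add: \<rho>_def N_def)
  have app: "\<rho> i = (if i = N then (if e then N else - N) else \<pi> i)"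
    if "i \<in> {1..N}" for i
    using insert_letter_apply[OF \<pi> pN, of i e] that by (simp add: \<rho>_def N_def)
  have other: "exc_arc (Suc n) \<rho> j = exc_arc n \<pi> j" if "j \<in> {1..int n}" for j
    using that app[of j] unfolding exc_arc_def range by (auto simp: N_def)
  have at_N: "exc_arc (Suc n) \<rho> N = (\<not> e)"
    using app[of N] pN unfolding exc_arc_def range by (auto simp: N_def)
  have split: "{1..int (Suc n)} = insert N {1..int n}" by (auto simp: N_def)
  have N_notin: "N \<notin> {1..int n}" by (simp add: N_def)
  have "exc (Suc n) \<rho> = of_bool (\<not> e) + (\<Sum>j\<in>{1..int n}. of_bool (exc_arc n \<pi> j))"
    unfolding exc_eq_sum[OF \<rho>] split using at_N other N_notin by (simp del: sum_of_bool_eq)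
  then show ?thesis by (auto simp: \<rho>_def N_def exc_eq_sum[OF \<pi>])
qed

section \<open>Parity classes\<close>

text \<open>Since this insertion changes nothing, its parity class at \<open>Suc n\<close> is
  governed by the next three lemmas, which compare the classes for \<open>n\<close> and
  \<open>Suc n\<close>.\<close>

lemma insert_letter_top: "insert_letter n True (int (Suc n)) \<pi> = \<pi>"
  by (auto simp: insert_letter_def signed_swap_def fun_eq_iff)

lemma inv_B_Suc:
  assumes \<pi>: "\<pi> \<in> signed_perms n"
  shows "inv_B (Suc n) \<pi> = inv_B n \<pi>"
proof -
  have N: "\<pi> (int (Suc n)) = int (Suc n)" using \<pi> signed_perms_Suc_iff by blast
  have lt: "\<pi> i < int (Suc n)" if "1 \<le> i" "i \<le> int n" for i
    using signed_perms_range(2)[OF \<pi>, of i] that by (simp add: abs_le_iff)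
  have top: "i = int (Suc n)" if "i \<le> int (Suc n)" "\<not> i \<le> int n" for i
    using that by simp
  have "{(i, j). 1 \<le> i \<and> i < j \<and> j \<le> int (Suc n) \<and> \<pi> i > \<pi> j} =
      {(i, j). 1 \<le> i \<and> i < j \<and> j \<le> int n \<and> \<pi> i > \<pi> j}"
  proof -
    have "j \<le> int n" if "1 \<le> i" "i < j" "j \<le> int (Suc n)" "\<pi> i > \<pi> j" for i j
    proof (rule ccontr)
      assume "\<not> j \<le> int n"
      with that top have "j = int (Suc n)" by blast
      with N lt[of i] that show False by simp
    qed
    then show ?thesis by force
  qed
  moreover have "{i \<in> {1..int (Suc n)}. \<pi> i < 0} = {i \<in> {1..int n}. \<pi> i < 0}"
  proof -
    have "i \<le> int n" if "i \<le> int (Suc n)" "\<pi> i < 0" for i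
    proof (rule ccontr)
      assume "\<not> i \<le> int n"
      with that top have "i = int (Suc n)" by blast
      with N that show False by simp
    qed
    then show ?thesis by force
  qed
  ultimately show ?thesis by (simp only: inv_B_def)
qed

lemma even_signed_perms_Suc:
  assumes \<pi>: "\<pi> \<in> signed_perms n"
  shows "\<pi> \<in> even_signed_perms (Suc n) \<longleftrightarrow> \<pi> \<in> even_signed_perms n"
proof -
  have N: "\<pi> (int (Suc n)) = int (Suc n)" "\<pi> \<in> signed_perms (Suc n)"
    using \<pi> signed_perms_Suc_iff by blast+
  have "i \<le> int n" if "i \<le> int (Suc n)" "\<pi> i < 0" for i
    using that N(1) by (cases "i = int (Suc n)") auto
  then have "{i \<in> {1..int (Suc n)}. \<pi> i < 0} = {i \<in> {1..int n}. \<pi> i < 0}"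
    by force
  with N(2) \<pi> show ?thesis by (simp add: even_signed_perms_def)
qed

lemma B_plus_Suc:
  "\<pi> \<in> signed_perms n \<Longrightarrow> \<pi> \<in> B_plus (Suc n) \<longleftrightarrow> \<pi> \<in> B_plus n"
  using signed_perms_Suc_iff[of \<pi> n] by (auto simp: B_plus_def inv_B_Suc)

context
  fixes n :: nat and p :: int and \<pi> :: "int \<Rightarrow> int"
  assumes \<pi>: "\<pi> \<in> signed_perms n" and p: "p \<in> {1..int (Suc n)}"
begin

private lemma in_signed_perms: "insert_letter n e p \<pi> \<in> signed_perms (Suc n)"
  by (rule insert_letter_in_signed_perms[OF \<pi> p])

private lemma at_p: "insert_letter n e p \<pi> p = (if e then int (Suc n) else - int (Suc n))"
  using insert_letter_apply[OF \<pi> p p] by simp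

private lemma off_p:
  assumes "i \<in> {1..int (Suc n)}" "i \<noteq> p"
  shows "insert_letter n False p \<pi> i = insert_letter n True p \<pi> i"
    and "\<bar>insert_letter n True p \<pi> i\<bar> < int (Suc n)"
proof -
  show "insert_letter n False p \<pi> i = insert_letter n True p \<pi> i"
    using insert_letter_apply[OF \<pi> p assms(1)] assms(2) by simp
  have "\<bar>insert_letter n True p \<pi> i\<bar> \<noteq> \<bar>insert_letter n True p \<pi> p\<bar>"
    using bij_betw_abs_signed_perm[OF in_signed_perms, of True] p assms
    unfolding bij_betw_def inj_on_def by blast
  then show "\<bar>insert_letter n True p \<pi> i\<bar> < int (Suc n)"
    using signed_perms_range(2)[OF in_signed_perms assms(1), of True] at_p[of True] by simp
qed

private lemma negatives:
  "{i \<in> {1..int (Suc n)}. insert_letter n False p \<pi> i < 0} =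
     insert p {i \<in> {1..int (Suc n)}. insert_letter n True p \<pi> i < 0}"
  "p \<notin> {i \<in> {1..int (Suc n)}. insert_letter n True p \<pi> i < 0}"
  "finite {i \<in> {1..int (Suc n)}. insert_letter n True p \<pi> i < 0}"
proof -
  show "{i \<in> {1..int (Suc n)}. insert_letter n False p \<pi> i < 0} =
     insert p {i \<in> {1..int (Suc n)}. insert_letter n True p \<pi> i < 0}"
  proof (rule set_eqI)
    fix i show "i \<in> {i \<in> {1..int (Suc n)}. insert_letter n False p \<pi> i < 0} \<longleftrightarrow>
      i \<in> insert p {i \<in> {1..int (Suc n)}. insert_letter n True p \<pi> i < 0}"
      using off_p(1)[of i] at_p[of False] p by (cases "i = p") auto
  qed
  show "p \<notin> {i \<in> {1..int (Suc n)}. insert_letter n True p \<pi> i < 0}"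
    using at_p[of True] by simp
  show "finite {i \<in> {1..int (Suc n)}. insert_letter n True p \<pi> i < 0}"
    by (rule finite_subset[of _ "{1..int (Suc n)}"]) auto
qed

lemma even_signed_perms_insert_letter:
  "insert_letter n False p \<pi> \<in> even_signed_perms (Suc n) \<longleftrightarrow>
   insert_letter n True p \<pi> \<notin> even_signed_perms (Suc n)"
  using negatives in_signed_perms by (simp add: even_signed_perms_def)

text \<open>Put \<open>N = n + 1\<close>. Negating the letter at position \<open>p\<close> trades
  its \<open>N - p\<close> inversions with later positions for \<open>p - 1\<close> inversions with
  earlier ones, and adds \<open>N\<close> to the sum over negative entries. Pairs avoiding
  \<open>p\<close> are unaffected. As \<open>N = (N - p) + (p - 1) + 1\<close>, the two values of
  \<open>inv_B\<close> have odd sum.\<close>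

lemma B_plus_insert_letter:
  "insert_letter n False p \<pi> \<in> B_plus (Suc n) \<longleftrightarrow>
   insert_letter n True p \<pi> \<notin> B_plus (Suc n)"
proof -
  define N where "N = int (Suc n)"
  define \<rho> where "\<rho> = insert_letter n True p \<pi>"
  define \<rho>' where "\<rho>' = insert_letter n False p \<pi>"
  define R where "R = {(i, j). 1 \<le> i \<and> i < j \<and> j \<le> N \<and> i \<noteq> p \<and> j \<noteq> p \<and> \<rho> i > \<rho> j}"
  have pN: "1 \<le> p" "p \<le> N" using p by (auto simp: N_def)
  have \<rho>: "\<rho> p = N" "\<And>i. 1 \<le> i \<Longrightarrow> i \<le> N \<Longrightarrow> i \<noteq> p \<Longrightarrow> \<bar>\<rho> i\<bar> < N"
    using at_p[of True] off_p(2) by (auto simp: \<rho>_def N_def)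
  have \<rho>': "\<rho>' p = - N" "\<And>i. 1 \<le> i \<Longrightarrow> i \<le> N \<Longrightarrow> i \<noteq> p \<Longrightarrow> \<rho>' i = \<rho> i"
    using at_p[of False] off_p(1) by (auto simp: \<rho>_def \<rho>'_def N_def)
  have finR: "finite R"
    by (rule finite_subset[of _ "{1..N} \<times> {1..N}"]) (auto simp: R_def)
  have "(1 \<le> i \<and> i < j \<and> j \<le> N \<and> \<rho> i > \<rho> j) \<longleftrightarrow>
      (i, j) \<in> R \<or> i = p \<and> j \<in> {p<..N}" for i j
    using \<rho>(1) \<rho>(2)[of i] \<rho>(2)[of j] pN
    by (cases "i = p"; cases "j = p") (auto simp: R_def)
  then have "{(i, j). 1 \<le> i \<and> i < j \<and> j \<le> N \<and> \<rho> i > \<rho> j} = R \<union> Pair p ` {p<..N}"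
    by auto
  moreover have "card (R \<union> Pair p ` {p<..N}) = card R + nat (N - p)"
  proof -
    have "R \<inter> Pair p ` {p<..N} = {}" by (auto simp: R_def)
    then show ?thesis by (simp add: card_Un_disjoint finR card_image inj_on_def)
  qed
  ultimately have inv: "card {(i, j). 1 \<le> i \<and> i < j \<and> j \<le> N \<and> \<rho> i > \<rho> j} = card R + nat (N - p)"
    by simp
  have "(1 \<le> i \<and> i < j \<and> j \<le> N \<and> \<rho>' i > \<rho>' j) \<longleftrightarrow>
      (i, j) \<in> R \<or> i \<in> {1..<p} \<and> j = p" for i j
    using \<rho>' \<rho>(2)[of i] \<rho>(2)[of j] \<rho>'(2)[of i] \<rho>'(2)[of j] pN
    by (cases "i = p"; cases "j = p") (auto simp: R_def)
  then have "{(i, j). 1 \<le> i \<and> i < j \<and> j \<le> N \<and> \<rho>' i > \<rho>' j} = R \<union> (\<lambda>i. (i, p)) ` {1..<p}"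
    by auto
  moreover have "card (R \<union> (\<lambda>i. (i, p)) ` {1..<p}) = card R + nat (p - 1)"
  proof -
    have "R \<inter> (\<lambda>i. (i, p)) ` {1..<p} = {}" by (auto simp: R_def)
    then show ?thesis by (simp add: card_Un_disjoint finR card_image inj_on_def)
  qed
  ultimately have inv': "card {(i, j). 1 \<le> i \<and> i < j \<and> j \<le> N \<and> \<rho>' i > \<rho>' j} = card R + nat (p - 1)"
    by simp
  let ?neg = "{i \<in> {1..N}. \<rho> i < 0}"
  have "(\<Sum>i\<in>{i \<in> {1..N}. \<rho>' i < 0}. nat \<bar>\<rho>' i\<bar>) = (\<Sum>i\<in>insert p ?neg. nat \<bar>\<rho>' i\<bar>)"
    using negatives(1) by (simp add: \<rho>_def \<rho>'_def N_def)
  also have "\<dots> = nat \<bar>\<rho>' p\<bar> + (\<Sum>i\<in>?neg. nat \<bar>\<rho>' i\<bar>)"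
    using negatives(2,3) by (simp add: \<rho>_def N_def)
  also have "(\<Sum>i\<in>?neg. nat \<bar>\<rho>' i\<bar>) = (\<Sum>i\<in>?neg. nat \<bar>\<rho> i\<bar>)"
  proof (rule sum.cong[OF refl])
    fix i assume "i \<in> ?neg"
    then have "i \<noteq> p" "1 \<le> i" "i \<le> N" using \<rho>(1) by (auto simp: N_def)
    then show "nat \<bar>\<rho>' i\<bar> = nat \<bar>\<rho> i\<bar>" using \<rho>'(2) by simp
  qed
  finally have neg: "(\<Sum>i\<in>{i \<in> {1..N}. \<rho>' i < 0}. nat \<bar>\<rho>' i\<bar>) =
      Suc n + (\<Sum>i\<in>?neg. nat \<bar>\<rho> i\<bar>)"
    using \<rho>' by (simp add: N_def)
  have "Suc n = nat (N - p) + nat (p - 1) + 1"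
    using pN by (simp add: N_def)
  then have "inv_B (Suc n) \<rho> + inv_B (Suc n) \<rho>' =
      2 * (card R + nat (N - p) + nat (p - 1) + (\<Sum>i\<in>?neg. nat \<bar>\<rho> i\<bar>)) + 1"
    using inv inv' neg by (simp add: inv_B_def N_def)
  then have "odd (inv_B (Suc n) \<rho> + inv_B (Suc n) \<rho>')" by simp
  then show ?thesis
    using in_signed_perms by (auto simp: B_plus_def \<rho>_def \<rho>'_def)
qed

end

section \<open>Recurrences for the excedance polynomials\<close>

definition exc_monom :: "nat \<Rightarrow> (int \<Rightarrow> int) \<Rightarrow> real poly poly" where
  "exc_monom n \<pi> = var_t ^ exc n \<pi> * var_s ^ nexc n \<pi>"

lemma exc_monom_insert_letter_top:
  assumes "\<pi> \<in> signed_perms n"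
  shows "exc_monom (Suc n) (insert_letter n e (int (Suc n)) \<pi>) =
    (if e then var_s else var_t) * exc_monom n \<pi>"
  using exc_le[OF assms] exc_insert_letter_top[OF assms, of e]
  by (simp add: exc_monom_def nexc_def Suc_diff_le)

lemma exc_monom_insert_letter:
  assumes "\<pi> \<in> signed_perms n" "p \<in> {1..int n}"
  shows "exc_monom (Suc n) (insert_letter n e p \<pi>) =
    (if exc_arc n \<pi> p then var_t ^ exc n \<pi> * var_s ^ Suc (n - exc n \<pi>)
     else var_t ^ Suc (exc n \<pi>) * var_s ^ (n - exc n \<pi>))"
  using exc_le[OF assms(1)] exc_insert_letter[OF assms, of e]
  by (simp add: exc_monom_def nexc_def Suc_diff_le)

text \<open>The insertions of \<open>n + 1\<close> and \<open>- (n + 1)\<close> into an existing cycle cancel, so only the new cycles,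
  of weight \<open>s\<close> and \<open>- t\<close>, survive.\<close>

lemma exc_poly_diff_complement:
  assumes sub: "\<And>n. A n \<subseteq> signed_perms n" and zero: "id \<in> A 0"
    and Suc_iff: "\<And>n \<pi>. \<pi> \<in> signed_perms n \<Longrightarrow> \<pi> \<in> A (Suc n) \<longleftrightarrow> \<pi> \<in> A n"
    and flip: "\<And>n p \<pi>. \<pi> \<in> signed_perms n \<Longrightarrow> p \<in> {1..int (Suc n)} \<Longrightarrow>
      insert_letter n False p \<pi> \<in> A (Suc n) \<longleftrightarrow> insert_letter n True p \<pi> \<notin> A (Suc n)"
  shows "exc_poly n (A n) - exc_poly n (signed_perms n - A n) = (var_s - var_t) ^ n"
proof -
  define \<chi> :: "nat \<Rightarrow> (int \<Rightarrow> int) \<Rightarrow> real poly poly"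
    where "\<chi> n \<pi> = (if \<pi> \<in> A n then 1 else - 1)" for n \<pi>
  have diff: "exc_poly n (A n) - exc_poly n (signed_perms n - A n) =
      (\<Sum>\<pi>\<in>signed_perms n. \<chi> n \<pi> * exc_monom n \<pi>)" for n
  proof -
    have "(\<Sum>\<pi>\<in>signed_perms n. \<chi> n \<pi> * exc_monom n \<pi>) =
      (\<Sum>\<pi>\<in>signed_perms n - A n. \<chi> n \<pi> * exc_monom n \<pi>) + (\<Sum>\<pi>\<in>A n. \<chi> n \<pi> * exc_monom n \<pi>)"
      by (rule sum.subset_diff[OF sub finite_signed_perms])
    also have "\<dots> = - exc_poly n (signed_perms n - A n) + exc_poly n (A n)"
      by (simp add: exc_poly_def exc_monom_def \<chi>_def flip: sum_negf)
    finally show ?thesis by simp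
  qed
  have flip': "\<chi> (Suc n) (insert_letter n False p \<pi>) = - \<chi> (Suc n) (insert_letter n True p \<pi>)"
    if "\<pi> \<in> signed_perms n" "p \<in> {1..int (Suc n)}" for n p \<pi>
    using flip[OF that] by (simp add: \<chi>_def)
  have split: "{1..int (Suc n)} = insert (int (Suc n)) {1..int n}" for n by auto
  have "(\<Sum>\<pi>\<in>signed_perms n. \<chi> n \<pi> * exc_monom n \<pi>) = (var_s - var_t) ^ n"
  proof (induction n)
    case 0
    then show ?case using zero
      by (simp add: signed_perms_0 \<chi>_def exc_monom_def exc_def nexc_def id_def)
  next
    case (Suc n)
    let ?f = "\<lambda>\<rho>. \<chi> (Suc n) \<rho> * exc_monom (Suc n) \<rho>"
    have "(\<Sum>p\<in>{1..int (Suc n)}. ?f (insert_letter n True p \<pi>) + ?f (insert_letter n False p \<pi>)) =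
        (var_s - var_t) * (\<chi> n \<pi> * exc_monom n \<pi>)" if \<pi>: "\<pi> \<in> signed_perms n" for \<pi>
    proof -
      have "?f (insert_letter n True p \<pi>) + ?f (insert_letter n False p \<pi>) = 0"
        if "p \<in> {1..int n}" for p
        using flip'[OF \<pi>, of p] that exc_monom_insert_letter[OF \<pi> that] by simp
      then have "(\<Sum>p\<in>{1..int (Suc n)}. ?f (insert_letter n True p \<pi>) + ?f (insert_letter n False p \<pi>)) =
          ?f (insert_letter n True (int (Suc n)) \<pi>) + ?f (insert_letter n False (int (Suc n)) \<pi>)"
        unfolding split by (subst sum.insert) auto
      also have "\<dots> = \<chi> (Suc n) \<pi> * (var_s * exc_monom n \<pi>) - \<chi> (Suc n) \<pi> * (var_t * exc_monom n \<pi>)"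
        using flip'[OF \<pi>, of "int (Suc n)"] exc_monom_insert_letter_top[OF \<pi>, of True]
          exc_monom_insert_letter_top[OF \<pi>, of False]
        by (simp add: insert_letter_top del: of_nat_Suc)
      also have "\<chi> (Suc n) \<pi> = \<chi> n \<pi>" using Suc_iff[OF \<pi>] by (simp add: \<chi>_def)
      finally show ?thesis by (simp add: algebra_simps)
    qed
    then show ?case
      by (simp add: sum_signed_perms_Suc Suc.IH flip: sum_distrib_left del: of_nat_Suc)
  qed
  with diff show ?thesis by simp
qed

lemma exc_poly_add_complement:
  assumes "A \<subseteq> signed_perms n"
  shows "exc_poly n A + exc_poly n (signed_perms n - A) = exc_poly n (signed_perms n)"
  using sum.subset_diff[OF assms finite_signed_perms, of "\<lambda>\<pi>. var_t ^ exc n \<pi> * var_s ^ nexc n \<pi>"]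
  by (simp add: exc_poly_def add.commute)

lemma exc_poly_signed_perms_0: "exc_poly 0 (signed_perms 0) = 1"
  by (simp add: exc_poly_def signed_perms_0 exc_def nexc_def)

text \<open>\<open>pderiv\<close> differentiates in the outer variable \<open>s\<close>, so
  \<open>s\<close> times the derivative is the Euler operator that reads off the exponent of
  \<open>s\<close>.\<close>

lemma pderiv_exc_monom:
  "var_s * pderiv (exc_monom n \<pi>) = of_nat (nexc n \<pi>) * exc_monom n \<pi>"
proof -
  have "pderiv (var_t ^ k) = 0" for k
    by (simp add: pderiv_power var_t_def pderiv_pCons)
  moreover have "var_s * pderiv (var_s ^ k) = of_nat k * var_s ^ k" for k
  proof -
    have "pderiv var_s = 1" by (simp add: var_s_def pderiv_pCons)
    then show ?thesis 
      by (cases k) (simp_all add: pderiv_power of_nat_poly del: power_Suc, simp)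
  qed
  ultimately show ?thesis
    by (simp add: exc_monom_def pderiv_mult mult.left_commute)
qed

text \<open>The derivative in \<open>t\<close> has been eliminated by Euler's identity for homogeneous
  polynomials.\<close>

lemma exc_poly_signed_perms_Suc:
  "exc_poly (Suc n) (signed_perms (Suc n)) =
     (of_nat (2 * n + 1) * var_s + var_t) * exc_poly n (signed_perms n) +
     2 * var_s * (var_t - var_s) * pderiv (exc_poly n (signed_perms n))"
proof -
  have split: "{1..int (Suc n)} = insert (int (Suc n)) {1..int n}" by auto
  let ?m = "exc_monom (Suc n)"
  have "(\<Sum>p\<in>{1..int (Suc n)}. ?m (insert_letter n True p \<pi>) + ?m (insert_letter n False p \<pi>)) =
      (of_nat (2 * n + 1) * var_s + var_t) * exc_monom n \<pi> +
      2 * var_s * (var_t - var_s) * pderiv (exc_monom n \<pi>)" if \<pi>: "\<pi> \<in> signed_perms n" for \<pi>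
  proof -
    define k where "k = exc n \<pi>"
    have k: "k \<le> n" using exc_le[OF \<pi>] by (simp add: k_def)
    have M: "exc_monom n \<pi> = var_t ^ k * var_s ^ (n - k)"
      by (simp add: exc_monom_def nexc_def k_def)
    \<comment> \<open>An excedance arc contributes the factor \<open>s\<close> and any other arc the
      factor \<open>t\<close>, for either sign of the letter; hence the factor 2.\<close>
    have "?m (insert_letter n True p \<pi>) + ?m (insert_letter n False p \<pi>) =
        2 * var_t * exc_monom n \<pi> + of_bool (exc_arc n \<pi> p) * (2 * (var_s - var_t) * exc_monom n \<pi>)"
      if "p \<in> {1..int n}" for p
      using exc_monom_insert_letter[OF \<pi> that]
      by (simp add: M flip: k_def) (simp add: algebra_simps)
    then have "(\<Sum>p\<in>{1..int n}. ?m (insert_letter n True p \<pi>) + ?m (insert_letter n False p \<pi>)) =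
        of_nat n * (2 * var_t * exc_monom n \<pi>) +
        (\<Sum>p\<in>{1..int n}. of_bool (exc_arc n \<pi> p)) * (2 * (var_s - var_t) * exc_monom n \<pi>)"
      by (simp add: sum.distrib sum_distrib_right)
    also have "(\<Sum>p\<in>{1..int n}. of_bool (exc_arc n \<pi> p)) = (of_nat k :: real poly poly)"
      by (simp add: k_def exc_eq_card_arc[OF \<pi>] Int_def)
    finally have "(\<Sum>p\<in>{1..int (Suc n)}. ?m (insert_letter n True p \<pi>) + ?m (insert_letter n False p \<pi>)) =
        (var_s + var_t) * exc_monom n \<pi> + (of_nat n * (2 * var_t * exc_monom n \<pi>) +
        of_nat k * (2 * (var_s - var_t) * exc_monom n \<pi>))"
      unfolding split using exc_monom_insert_letter_top[OF \<pi>]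
      by (subst sum.insert) (auto simp: distrib_right simp del: of_nat_Suc)
    \<comment> \<open>The weight \<open>2 (k s + (n - k) t)\<close> of the old arcs becomes
      \<open>2 n s + 2 (n - k) (t - s)\<close>, and \<open>n - k\<close> is the exponent of
      \<open>s\<close> that the derivative produces.\<close>
    moreover have "of_nat n = of_nat k + (of_nat (n - k) :: real poly poly)"
      using k by (simp flip: of_nat_add)
    moreover have "2 * var_s * (var_t - var_s) * pderiv (exc_monom n \<pi>) =
        2 * (var_t - var_s) * (of_nat (n - k) * exc_monom n \<pi>)"
      using pderiv_exc_monom[of n \<pi>] by (simp add: nexc_def k_def mult_ac)
    ultimately show ?thesis by (simp add: algebra_simps)
  qed
  then have "exc_poly (Suc n) (signed_perms (Suc n)) =
      (\<Sum>\<pi>\<in>signed_perms n. (of_nat (2 * n + 1) * var_s + var_t) * exc_monom n \<pi> +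
        2 * var_s * (var_t - var_s) * pderiv (exc_monom n \<pi>))"
    by (simp add: exc_poly_def sum_signed_perms_Suc flip: exc_monom_def del: of_nat_Suc of_nat_add)
  then show ?thesis
    by (simp add: exc_poly_def sum.distrib higher_pderiv_sum[of 1, simplified] flip: exc_monom_def sum_distrib_left
        del: of_nat_Suc of_nat_add)
qed

section \<open>Gamma expansions\<close>

text \<open>\<open>left_peaks n i\<close> counts the permutations of \<open>[n]\<close> with \<open>i\<close> left peaks; the type B gamma
  coefficients are \<open>4 ^ i\<close> times these numbers.\<close>

fun left_peaks :: "nat \<Rightarrow> nat \<Rightarrow> nat" where
  "left_peaks 0 0 = 1"
| "left_peaks 0 (Suc i) = 0"
| "left_peaks (Suc n) 0 = left_peaks n 0"
| "left_peaks (Suc n) (Suc i) =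
     (2 * i + 3) * left_peaks n (Suc i) + (n - 2 * i) * left_peaks n i"

lemma left_peaks_0 [simp]: "left_peaks n 0 = 1"
  by (induction n) auto

text \<open>In the inductive step \<open>n \<le> 2 * i\<close>, so the truncated factor
  \<open>n - 2 * i\<close> is 0, and the other summand vanishes by induction.\<close>

lemma left_peaks_eq_0: "n < 2 * i \<Longrightarrow> left_peaks n i = 0"
  by (induction n i rule: left_peaks.induct) auto

text \<open>In the relevant range both factors of the recurrence are at least 1, so
  \<open>left_peaks\<close> grows at least as fast as Pascal's rule prescribes, while
  \<open>n div 2\<close> rises by at most one per step.\<close>

lemma binomial_le_left_peaks: "(n div 2) choose i \<le> left_peaks n i"
proof (induction n i rule: left_peaks.induct)
  case (4 n i)
  show ?case
  proof (cases "2 * Suc i \<le> Suc n")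
    case False
    then have "Suc n div 2 < Suc i" by simp
    then show ?thesis by (simp add: binomial_eq_0)
  next
    case True
    have "Suc n div 2 choose Suc i \<le> Suc (n div 2) choose Suc i"
      by (intro binomial_right_mono) simp
    also have "\<dots> = (n div 2 choose i) + (n div 2 choose Suc i)" by simp
    also have "\<dots> \<le> left_peaks n i + left_peaks n (Suc i)"
      using 4 by simp
    also have "\<dots> \<le> (n - 2 * i) * left_peaks n i + (2 * i + 3) * left_peaks n (Suc i)"
    proof -
      have "1 \<le> n - 2 * i" using True by simp
      then have "1 * left_peaks n i \<le> (n - 2 * i) * left_peaks n i" by (rule mult_le_mono1)
      then show ?thesis by (intro add_mono) simp_all
    qed
    finally show ?thesis by simp
  qed
qed auto

section \<open>Gamma terms under the type B recurrence\<close>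

definition gamma_term :: "nat \<Rightarrow> nat \<Rightarrow> real poly poly" where
  "gamma_term d i = (var_s * var_t) ^ i * (var_s + var_t) ^ (d - 2 * i)"

lemma pderiv_var: "pderiv var_s = 1" "pderiv var_t = 0"
  by (simp_all add: var_s_def var_t_def pderiv_pCons)

lemma pderiv_power_of_nat: "pderiv (p ^ n) = of_nat n * p ^ (n - 1) * pderiv p"
  by (simp add: pderiv_power of_nat_poly)

text \<open>Write the gamma term as \<open>U * V\<close> with \<open>U\<close> a power of
  \<open>s t\<close> and \<open>V\<close> a power of \<open>s + t\<close>. The Euler identities
  \<open>s U' = i U\<close> and \<open>(s + t) V' = j V\<close> absorb the derivative and leave just
  two gamma terms.\<close>

lemma recurrence_gamma_term:
  assumes "2 * i \<le> n"
  shows "(of_nat (2 * n + 1) * var_s + var_t) * gamma_term n i +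
      2 * var_s * (var_t - var_s) * pderiv (gamma_term n i) =
    of_nat (2 * i + 1) * gamma_term (Suc n) i +
    of_nat (4 * (n - 2 * i)) * gamma_term (Suc n) (Suc i)"
proof -
  obtain j where n: "n = 2 * i + j" using assms le_Suc_ex by blast
  define s t where "s = var_s" and "t = var_t"
  define U V where "U = (s * t) ^ i" and "V = (s + t) ^ j"
  define U' V' where "U' = pderiv U" and "V' = pderiv V"
  have U'_eq: "U' = of_nat i * (s * t) ^ (i - 1) * t"
    by (simp add: U'_def U_def s_def t_def pderiv_power_of_nat pderiv_mult pderiv_var)
  have V'_eq: "V' = of_nat j * (s + t) ^ (j - 1)"
    by (simp add: V'_def V_def s_def t_def pderiv_power_of_nat pderiv_add pderiv_var)
  have U': "s * U' = of_nat i * U"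
    unfolding U'_eq U_def by (cases i) (simp_all add: mult_ac)
  have V': "(s + t) * V' = of_nat j * V"
    unfolding V'_eq V_def by (cases j) (simp_all add: mult_ac)
  \<comment> \<open>For \<open>j = 0\<close> the exponent in the last gamma term is truncated; the
    factor \<open>of_nat j\<close> makes both sides 0 in that case.\<close>
  have terms: "gamma_term n i = U * V" "gamma_term (Suc n) i = U * ((s + t) * V)"
    "of_nat j * gamma_term (Suc n) (Suc i) = s * t * U * V'"
    by (simp_all add: gamma_term_def n U_def V_def V'_eq s_def[symmetric] t_def[symmetric]
        Suc_diff_le mult_ac)
  have "(of_nat (2 * n + 1) * s + t) * (U * V) + 2 * s * (t - s) * (U * V' + V * U') =
      of_nat (2 * n + 1) * s * U * V + t * U * V + 2 * s * (t - s) * U * V' + 2 * (t - s) * V * (s * U')"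
    by (simp add: algebra_simps)
  also have "\<dots> = of_nat (2 * i + 1) * (U * ((s + t) * V)) + 4 * (s * t * U * V') +
      2 * U * s * (of_nat j * V - (s + t) * V')"
    unfolding U' by (simp add: n algebra_simps)
  also have "\<dots> = of_nat (2 * i + 1) * (U * ((s + t) * V)) + 4 * (s * t * U * V')"
    unfolding V' by simp
  also have "\<dots> = of_nat (2 * i + 1) * gamma_term (Suc n) i +
      of_nat (4 * (n - 2 * i)) * gamma_term (Suc n) (Suc i)"
    unfolding terms(2) using terms(3) by (simp add: n mult.assoc)
  finally show ?thesis
    unfolding terms(1) by (simp add: pderiv_mult s_def t_def U'_def V'_def)
qed

text \<open>Summing up to \<open>n\<close> instead of \<open>n div 2\<close> spares the index shift
  a case distinction on parity; the surplus coefficients are 0.\<close>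

lemma exc_poly_signed_perms_gamma_terms:
  "exc_poly n (signed_perms n) = (\<Sum>i\<le>n. of_nat (4 ^ i * left_peaks n i) * gamma_term n i)"
proof (induction n)
  case 0
  then show ?case by (simp add: exc_poly_signed_perms_0 gamma_term_def)
next
  case (Suc n)
  define c where "c n i = (of_nat (4 ^ i * left_peaks n i) :: real poly poly)" for n i
  define R where "R F = (of_nat (2 * n + 1) * var_s + var_t) * F + 2 * var_s * (var_t - var_s) * pderiv F"
    for F
  have const: "pderiv (of_nat k * F) = of_nat k * pderiv F" for k and F :: "real poly poly"
    by (simp add: pderiv_mult)
  have R_sum: "R (\<Sum>i\<le>n. of_nat (a i) * F i) = (\<Sum>i\<le>n. of_nat (a i) * R (F i))" for a F
  proof -
    have "pderiv (\<Sum>i\<le>n. of_nat (a i) * F i) = (\<Sum>i\<le>n. of_nat (a i) * pderiv (F i))"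
      by (simp add: higher_pderiv_sum[of 1, simplified] const)
    then show ?thesis
      unfolding R_def by (simp only: sum_distrib_left sum.distrib[symmetric])
        (rule sum.cong, simp_all add: algebra_simps)
  qed
  have "exc_poly (Suc n) (signed_perms (Suc n)) = (\<Sum>i\<le>n. c n i * R (gamma_term n i))"
    unfolding c_def exc_poly_signed_perms_Suc Suc.IH R_sum[symmetric] by (simp add: R_def)
  also have "\<dots> = (\<Sum>i\<le>n. c n i * (of_nat (2 * i + 1) * gamma_term (Suc n) i +
      of_nat (4 * (n - 2 * i)) * gamma_term (Suc n) (Suc i)))"
  \<comment> \<open>The recurrence for gamma terms requires \<open>2 * i \<le> n\<close>; beyond
    that range the coefficient \<open>c n i\<close> vanishes.\<close>
  proof (rule sum.cong[OF refl])
    fix i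
    show "c n i * R (gamma_term n i) = c n i * (of_nat (2 * i + 1) * gamma_term (Suc n) i +
      of_nat (4 * (n - 2 * i)) * gamma_term (Suc n) (Suc i))"
      using recurrence_gamma_term[of i n] left_peaks_eq_0[of n i]
      by (cases "2 * i \<le> n") (simp_all add: R_def c_def)
  qed
  also have "\<dots> = (\<Sum>i\<le>n. of_nat (2 * i + 1) * c n i * gamma_term (Suc n) i) +
      (\<Sum>i\<le>n. of_nat (4 * (n - 2 * i)) * c n i * gamma_term (Suc n) (Suc i))"
    by (simp add: distrib_left sum.distrib mult_ac)
  also have "(\<Sum>i\<le>n. of_nat (2 * i + 1) * c n i * gamma_term (Suc n) i) =
      (\<Sum>i\<le>Suc n. of_nat (2 * i + 1) * c n i * gamma_term (Suc n) i)"
    using left_peaks_eq_0[of n "Suc n"] by (simp add: c_def)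
  also have "\<dots> = gamma_term (Suc n) 0 +
      (\<Sum>i\<le>n. of_nat (2 * i + 3) * c n (Suc i) * gamma_term (Suc n) (Suc i))"
    by (subst sum.atMost_Suc_shift) (simp add: c_def algebra_simps)
  also have "\<dots> + (\<Sum>i\<le>n. of_nat (4 * (n - 2 * i)) * c n i * gamma_term (Suc n) (Suc i)) =
      c (Suc n) 0 * gamma_term (Suc n) 0 + (\<Sum>i\<le>n. c (Suc n) (Suc i) * gamma_term (Suc n) (Suc i))"
  proof -
    \<comment> \<open>One factor 4 is absorbed by passing from \<open>4 ^ i\<close> to
      \<open>4 ^ Suc i\<close>; the rest is the recurrence defining
      \<open>left_peaks\<close>.\<close>
    have "c (Suc n) (Suc i) = of_nat (2 * i + 3) * c n (Suc i) + of_nat (4 * (n - 2 * i)) * c n i" for i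
      unfolding c_def of_nat_mult[symmetric] of_nat_add[symmetric]
      by (rule arg_cong[of _ _ of_nat]) (simp add: algebra_simps)
    then show ?thesis by (simp add: c_def sum.distrib distrib_right del: left_peaks.simps)
  qed
  also have "\<dots> = (\<Sum>i\<le>Suc n. c (Suc n) i * gamma_term (Suc n) i)"
    by (rule sum.atMost_Suc_shift[symmetric])
  finally show ?case by (simp add: c_def)
qed

lemma exc_poly_signed_perms_gamma:
  "exc_poly n (signed_perms n) =
     (\<Sum>i\<le>n div 2. [:[:4 ^ i * real (left_peaks n i):]:] * gamma_term n i)"
proof -
  have "exc_poly n (signed_perms n) = (\<Sum>i\<le>n div 2. of_nat (4 ^ i * left_peaks n i) * gamma_term n i)"
    unfolding exc_poly_signed_perms_gamma_terms
    by (rule sum.mono_neutral_right) (auto simp: left_peaks_eq_0)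
  then show ?thesis by (simp add: of_nat_poly)
qed

lemma diff_power_gamma:
  "(var_s - var_t) ^ (2 * m) =
     (\<Sum>i\<le>m. [:[:(- 4) ^ i * real (m choose i):]:] * gamma_term (2 * m) i)"
proof -
  define c :: "real poly poly" where "c = [:[:- 4:]:]"
  have "(var_s - var_t) ^ (2 * m) = ((var_s - var_t) ^ 2) ^ m"
    by (simp add: power_mult)
  also have "(var_s - var_t) ^ 2 = c * (var_s * var_t) + (var_s + var_t) ^ 2"
  proof -
    have "c = - 4" by (simp add: c_def numeral_poly)
    then show ?thesis by (simp add: power2_eq_square algebra_simps)
  qed
  also have "\<dots> ^ m = (\<Sum>i\<le>m. of_nat (m choose i) * (c * (var_s * var_t)) ^ i *
      ((var_s + var_t) ^ 2) ^ (m - i))"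
    by (rule binomial_ring)
  also have "\<dots> = (\<Sum>i\<le>m. [:[:(- 4) ^ i * real (m choose i):]:] * gamma_term (2 * m) i)"
  proof (rule sum.cong[OF refl])
    fix i
    have "[:[:(- 4) ^ i * real (m choose i):]:] = c ^ i * of_nat (m choose i)"
      by (simp add: of_nat_poly poly_const_pow c_def)
    then show "of_nat (m choose i) * (c * (var_s * var_t)) ^ i *
        ((var_s + var_t) ^ 2) ^ (m - i) = [:[:(- 4) ^ i * real (m choose i):]:] * gamma_term (2 * m) i"
      by (simp add: gamma_term_def power_mult_distrib mult_ac diff_mult_distrib flip: power_mult)
  qed
  finally show ?thesis .
qed

section \<open>Gamma sums and criteria for gamma positivity\<close>

definition gamma_sum :: "nat \<Rightarrow> (nat \<Rightarrow> real) \<Rightarrow> real poly poly" where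
  "gamma_sum d \<gamma> = (\<Sum>i\<le>d div 2. [:[:\<gamma> i:]:] * gamma_term d i)"

lemma gamma_sum_add: "gamma_sum d a + gamma_sum d b = gamma_sum d (\<lambda>i. a i + b i)"
  by (simp add: gamma_sum_def smult_add_left flip: sum.distrib) (simp flip: smult_add_left)

lemma gamma_sum_diff: "gamma_sum d a - gamma_sum d b = gamma_sum d (\<lambda>i. a i - b i)"
  by (simp add: gamma_sum_def flip: sum_subtractf) (simp flip: smult_diff_left)

lemma gamma_sum_half: "2 * gamma_sum d (\<lambda>i. a i / 2) = gamma_sum d a"
proof -
  have "2 * gamma_sum d (\<lambda>i. a i / 2) = gamma_sum d (\<lambda>i. a i / 2) + gamma_sum d (\<lambda>i. a i / 2)"
    by simp
  then show ?thesis by (simp add: gamma_sum_add)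
qed

lemma poly_gamma_sum:
  "poly (gamma_sum d \<gamma>) 1 = (\<Sum>i\<le>d div 2. smult (\<gamma> i) ([:0, 1:] ^ i * [:1, 1:] ^ (d - 2 * i)))"
  by (simp add: gamma_sum_def gamma_term_def poly_sum poly_power var_s_def var_t_def one_pCons)

text \<open>Evaluation at \<open>s = t = 1\<close> is a ring homomorphism that kills
  \<open>s - t\<close>. A nonzero value certifies that a polynomial is nonzero, as both notions of
  gamma positivity demand.\<close>

definition eval_one :: "real poly poly \<Rightarrow> real" where
  "eval_one F = poly (poly F 1) 1"

lemma eval_one_simps [simp]:
  "eval_one (F + G) = eval_one F + eval_one G" "eval_one (F - G) = eval_one F - eval_one G"
  "eval_one (F * G) = eval_one F * eval_one G" "eval_one (F ^ k) = eval_one F ^ k"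
  "eval_one var_s = 1" "eval_one var_t = 1" "eval_one 0 = 0" "eval_one 2 = 2"
  by (simp_all add: eval_one_def var_s_def var_t_def poly_power)

lemma eval_one_gamma_sum_pos:
  assumes "\<And>i. i \<le> d div 2 \<Longrightarrow> \<gamma> i \<ge> 0" "\<gamma> 0 > 0"
  shows "eval_one (gamma_sum d \<gamma>) > 0"
proof -
  have "eval_one (gamma_sum d \<gamma>) = (\<Sum>i\<le>d div 2. \<gamma> i * 2 ^ (d - 2 * i))"
    by (simp add: eval_one_def poly_gamma_sum poly_sum poly_power)
  also have "\<dots> > 0"
    using assms by (intro sum_pos2[of _ 0]) auto
  finally show ?thesis .
qed

text \<open>The given \<open>a\<close> and \<open>d\<close> may differ from the low degree and width
  of \<open>f\<close>, since initial coefficients can vanish. If \<open>k\<close> is the first index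
  with \<open>\<gamma> k \<noteq> 0\<close>, then \<open>f\<close> has low degree
  \<open>a + k\<close> and degree \<open>a + (d - k)\<close>, and shifting the index by
  \<open>k\<close> gives the expansion required by the definition.\<close>

lemma gamma_positiveI:
  assumes f: "f = (\<Sum>i\<le>d div 2. smult (\<gamma> i) ([:0, 1:] ^ (a + i) * [:1, 1:] ^ (d - 2 * i)))"
    and nonneg: "\<And>i. i \<le> d div 2 \<Longrightarrow> \<gamma> i \<ge> 0" and nz: "f \<noteq> 0"
  shows "gamma_positive f"
proof -
  define g :: "nat \<Rightarrow> real poly" where "g i = [:0, 1:] ^ (a + i) * [:1, 1:] ^ (d - 2 * i)" for i
  have "\<exists>i. i \<le> d div 2 \<and> \<gamma> i \<noteq> 0"
  proof (rule ccontr)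
    assume "\<nexists>i. i \<le> d div 2 \<and> \<gamma> i \<noteq> 0"
    then have "f = 0" unfolding f by (intro sum.neutral) auto
    with nz show False by simp
  qed
  define k where "k = (LEAST i. i \<le> d div 2 \<and> \<gamma> i \<noteq> 0)"
  have k: "k \<le> d div 2" "\<gamma> k \<noteq> 0"
    using LeastI_ex[OF \<open>\<exists>i. i \<le> d div 2 \<and> \<gamma> i \<noteq> 0\<close>] by (simp_all add: k_def)
  have below: "\<gamma> i = 0" if "i < k" for i
    using not_less_Least[of i "\<lambda>i. i \<le> d div 2 \<and> \<gamma> i \<noteq> 0"] that k(1) by (auto simp: k_def)
  have monom: "[:0, 1::real:] ^ j = monom 1 j" for j
    by (simp add: monom_altdef)
  have low: "coeff (g i) j = 0" if "j < a + i" for i j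
    using that by (simp add: g_def monom coeff_monom_mult)
  have low': "coeff (g i) (a + i) = 1" for i
    by (simp add: g_def monom coeff_monom_mult coeff_0_power)
  have deg: "degree (g i) = a + (d - i)" if "i \<le> d div 2" for i
    using that by (simp add: g_def degree_mult_eq degree_power_eq)
  have lead: "coeff (g i) (a + (d - i)) = 1" if "i \<le> d div 2" for i
  proof -
    have "lead_coeff (g i) = 1" by (simp add: g_def lead_coeff_mult lead_coeff_power)
    then show ?thesis using deg[OF that] by simp
  qed
  have coeff_f: "coeff f j = (\<Sum>i\<le>d div 2. \<gamma> i * coeff (g i) j)" for j
    by (simp add: f g_def coeff_sum)
  \<comment> \<open>Terms before \<open>k\<close> have coefficient 0 and terms after
    \<open>k\<close> start in a higher degree.\<close>
  have "coeff f (a + k) = (\<Sum>i\<in>{k}. \<gamma> i * coeff (g i) (a + k))"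
    unfolding coeff_f using k(1) below low
    by (intro sum.mono_neutral_right) (auto, meson add_less_cancel_left linorder_neqE_nat)
  then have "coeff f (a + k) \<noteq> 0" using k(2) low' by simp
  moreover have "coeff f j = 0" if "j < a + k" for j
    unfolding coeff_f
  proof (rule sum.neutral, rule ballI)
    fix i
    show "\<gamma> i * coeff (g i) j = 0"
      using below[of i] low[of j i] that by (cases "i < k") auto
  qed
  ultimately have low_degree: "low_degree f = a + k"
    unfolding low_degree_def by (intro Least_equality) (auto simp: not_less[symmetric])
  \<comment> \<open>The same at the top: the degree \<open>a + (d - i)\<close> of \<open>g i\<close>
    decreases as \<open>i\<close> grows, so later terms do not reach this degree.\<close>
  have "coeff f (a + (d - k)) = (\<Sum>i\<in>{k}. \<gamma> i * coeff (g i) (a + (d - k)))"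
    unfolding coeff_f
  proof (rule sum.mono_neutral_right)
    show "\<forall>i\<in>{..d div 2} - {k}. \<gamma> i * coeff (g i) (a + (d - k)) = 0"
    proof
      fix i assume i: "i \<in> {..d div 2} - {k}"
      show "\<gamma> i * coeff (g i) (a + (d - k)) = 0"
      proof (cases "i < k")
        case False
        then have "degree (g i) < a + (d - k)" using deg[of i] i by auto
        then show ?thesis by (simp add: coeff_eq_0)
      qed (simp add: below)
    qed
  qed (use k in auto)
  then have "coeff f (a + (d - k)) \<noteq> 0" using k lead by simp
  then have "degree f \<ge> a + (d - k)" by (rule le_degree)
  moreover have "degree f \<le> a + (d - k)"
  proof (rule degree_le, intro allI impI)
    fix j assume j: "a + (d - k) < j"
    show "coeff f j = 0"
      unfolding coeff_f
    proof (rule sum.neutral, rule ballI)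
      fix i assume i: "i \<in> {..d div 2}"
      show "\<gamma> i * coeff (g i) j = 0"
      proof (cases "i < k")
        case False
        then have "degree (g i) < j" using deg[of i] i j by auto
        then show ?thesis by (simp add: coeff_eq_0)
      qed (simp add: below)
    qed
  qed
  ultimately have width: "degree f - low_degree f = d - 2 * k"
    using low_degree by simp
  have "f = (\<Sum>i\<in>{k..d div 2}. smult (\<gamma> i) (g i))"
    unfolding f g_def using below by (intro sum.mono_neutral_right) auto
  also have "\<dots> = (\<Sum>i\<in>{0..(d - 2 * k) div 2}. smult (\<gamma> (i + k)) (g (i + k)))"
  proof -
    have "{k..d div 2} = {0 + k..(d - 2 * k) div 2 + k}" using k(1) by auto
    then show ?thesis by (simp only: sum.shift_bounds_cl_nat_ivl)
  qed
  also have "\<dots> = (\<Sum>i\<le>(d - 2 * k) div 2. smult (\<gamma> (i + k))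
      ([:0, 1:] ^ (a + k + i) * [:1, 1:] ^ (d - 2 * k - 2 * i)))"
    by (simp add: g_def atLeast0AtMost algebra_simps)
  finally have f_eq: "f = \<dots>" .
  have nonneg': "\<gamma> (i + k) \<ge> 0" if "i \<le> (d - 2 * k) div 2" for i
    using nonneg[of "i + k"] that k(1) by simp
  show ?thesis
    unfolding gamma_positive_def width
    unfolding low_degree
    by (intro conjI exI[of _ "\<lambda>i. \<gamma> (i + k)"] nz f_eq) (use nonneg' in blast)
qed

text \<open>The free power of \<open>t\<close> serves odd \<open>n\<close>, where one of the two
  summands carries an extra factor \<open>t\<close>.\<close>

lemma gamma_positive_gamma_sum:
  assumes "\<And>i. i \<le> d div 2 \<Longrightarrow> \<gamma> i \<ge> 0" "eval_one (gamma_sum d \<gamma>) \<noteq> 0"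
  shows "gamma_positive ([:0, 1:] ^ a * poly (gamma_sum d \<gamma>) 1)"
proof (rule gamma_positiveI[OF _ assms(1)])
  show "[:0, 1:] ^ a * poly (gamma_sum d \<gamma>) 1 =
    (\<Sum>i\<le>d div 2. smult (\<gamma> i) ([:0, 1:] ^ (a + i) * [:1, 1:] ^ (d - 2 * i)))"
    by (simp add: poly_gamma_sum sum_distrib_left power_add mult.assoc)
  show "[:0, 1:] ^ a * poly (gamma_sum d \<gamma>) 1 \<noteq> 0"
    using assms(2) by (auto simp: eval_one_def)
qed

section \<open>Homogeneity, the doubled parity classes and the final assembly\<close>

lemma homogeneous_exc_poly:
  assumes "A \<subseteq> signed_perms n"
  shows "homogeneous n (exc_poly n A)"
proof -
  have monom: "var_t ^ k * var_s ^ l = monom (monom 1 k) l" for k l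
  proof -
    have "var_t ^ k = [:monom 1 k:]"
      by (simp add: var_t_def poly_const_pow monom_altdef)
    moreover have "var_s ^ l = monom 1 l"
      by (simp add: var_s_def monom_altdef)
    ultimately show ?thesis by (simp add: smult_monom)
  qed
  have "i + j = n" if "coeff (coeff (exc_poly n A) i) j \<noteq> 0" for i j
  proof -
    have "(\<Sum>\<pi>\<in>A. coeff (coeff (monom (monom 1 (exc n \<pi>)) (nexc n \<pi>)) i) j :: real) \<noteq> 0"
      using that by (simp add: exc_poly_def monom coeff_sum)
    then obtain \<pi> where "\<pi> \<in> A"
      "coeff (coeff (monom (monom (1::real) (exc n \<pi>)) (nexc n \<pi>)) i) j \<noteq> 0"
      by (rule sum.not_neutral_contains_not_neutral)
    then have "\<pi> \<in> signed_perms n" "nexc n \<pi> = i" "exc n \<pi> = j"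
      using assms by (auto simp: split: if_splits)
    \<comment> \<open>The subtraction in \<open>nexc\<close> does not truncate, because
      \<open>exc\<close> is at most \<open>n\<close>.\<close>
    then show ?thesis using exc_le[of \<pi> n] by (auto simp: nexc_def)
  qed
  then show ?thesis by (simp add: homogeneous_def)
qed

lemma gamma_positive_bivI:
  assumes "homogeneous d (gamma_sum d \<gamma>)" "\<And>i. i \<le> d div 2 \<Longrightarrow> \<gamma> i \<ge> 0"
    "eval_one (gamma_sum d \<gamma>) \<noteq> 0"
  shows "gamma_positive_biv (gamma_sum d \<gamma>) (real d / 2)"
  unfolding gamma_positive_biv_def
proof (intro conjI exI[of _ d] exI[of _ \<gamma>])
  show "gamma_sum d \<gamma> \<noteq> 0" using assms(3) by auto
qed (use assms in \<open>auto simp: gamma_sum_def gamma_term_def mult.assoc\<close>)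

text \<open>Both the sum and the difference of a class and its complement are known. Keeping
  \<open>A\<close> abstract covers the parity of the number of negative entries and that of
  \<open>inv_B\<close> at once, and the equal right-hand sides identify the polynomials. The factor
  2 avoids halving in \<open>real poly poly\<close>.\<close>

lemma double_parity_class:
  assumes "\<And>n. A n \<subseteq> signed_perms n" "id \<in> A 0"
    and "\<And>n \<pi>. \<pi> \<in> signed_perms n \<Longrightarrow> \<pi> \<in> A (Suc n) \<longleftrightarrow> \<pi> \<in> A n"
    and "\<And>n p \<pi>. \<pi> \<in> signed_perms n \<Longrightarrow> p \<in> {1..int (Suc n)} \<Longrightarrow>
      insert_letter n False p \<pi> \<in> A (Suc n) \<longleftrightarrow> insert_letter n True p \<pi> \<notin> A (Suc n)"
  shows "2 * exc_poly n (A n) = exc_poly n (signed_perms n) + (var_s - var_t) ^ n"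
    and "2 * exc_poly n (signed_perms n - A n) = exc_poly n (signed_perms n) - (var_s - var_t) ^ n"
  using exc_poly_diff_complement[OF assms, of n] exc_poly_add_complement[OF assms(1)[of n]]
  by (simp_all add: algebra_simps flip: mult_2)

lemma double_DExc: "2 * DExc n = exc_poly n (signed_perms n) + (var_s - var_t) ^ n"
  and double_BDExc: "2 * BDExc n = exc_poly n (signed_perms n) - (var_s - var_t) ^ n"
  unfolding DExc_def BDExc_def
  by (rule double_parity_class[of even_signed_perms];
      (rule even_signed_perms_Suc even_signed_perms_insert_letter)?;
      auto simp: even_signed_perms_def id_in_signed_perms)+

lemma inv_B_0: "inv_B 0 \<pi> = 0"
proof -
  have "{(i, j). 1 \<le> i \<and> i < j \<and> j \<le> int 0 \<and> \<pi> i > \<pi> j} = {}" by auto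
  then have "card {(i, j). 1 \<le> i \<and> i < j \<and> j \<le> int 0 \<and> \<pi> i > \<pi> j} = 0"
    by (simp only: card.empty)
  then show ?thesis unfolding inv_B_def by (simp only: add_0) simp
qed

lemma double_BExc_plus: "2 * BExc_plus n = exc_poly n (signed_perms n) + (var_s - var_t) ^ n"
  and double_BExc_minus: "2 * BExc_minus n = exc_poly n (signed_perms n) - (var_s - var_t) ^ n"
  unfolding BExc_plus_def BExc_minus_def B_minus_def
  by (rule double_parity_class[of B_plus];
      (rule B_plus_Suc B_plus_insert_letter)?;
      simp add: B_plus_def inv_B_0 id_in_signed_perms)+

theorem theorem29:
  fixes n :: nat
  assumes "n \<ge> 2"
  shows "BExc_plus n = DExc n \<and> BExc_minus n = BDExc n \<and>
         (even n \<longrightarrow> gamma_positive_biv (DExc n) (real n / 2) \<and>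
                    gamma_positive_biv (BDExc n) (real n / 2)) \<and>
         (odd n \<longrightarrow> (\<exists>f g. gamma_positive f \<and> gamma_positive g \<and> DExc_uni n = f + g) \<and>
                   (\<exists>f g. gamma_positive f \<and> gamma_positive g \<and> BDExc_uni n = f + g))"
proof -
  have cancel: "F = G" if "2 * F = 2 * G" for F G :: "real poly poly"
    using that by simp
  define m where "m = n div 2"
  have m: "m \<ge> 1" using assms by (simp add: m_def)
  \<comment> \<open>\<open>a\<close> lists the gamma coefficients of the full sum, \<open>b\<close>
    those of \<open>(s - t)\<close> to the power \<open>2 * m\<close>.\<close>
  define a b where "a i = 4 ^ i * real (left_peaks n i)" and "b i = (- 4) ^ i * real (m choose i)" for i
  have b_le: "\<bar>b i\<bar> \<le> a i" for i
    using binomial_le_left_peaks[of n i] by (simp add: a_def b_def m_def abs_mult power_abs)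
  have nonneg: "(a i + b i) / 2 \<ge> 0" "(a i - b i) / 2 \<ge> 0" for i
    using b_le[of i] by (simp_all add: abs_le_iff minus_le_iff)
  define G P M where "G = gamma_sum (2 * m) a" and "P = gamma_sum (2 * m) (\<lambda>i. (a i + b i) / 2)"
    and "M = gamma_sum (2 * m) (\<lambda>i. (a i - b i) / 2)"
  have H: "gamma_sum (2 * m) b = (var_s - var_t) ^ (2 * m)"
    by (simp add: diff_power_gamma gamma_sum_def b_def)
  have P: "2 * P = G + (var_s - var_t) ^ (2 * m)" and M: "2 * M = G - (var_s - var_t) ^ (2 * m)"
    by (simp_all add: P_def M_def G_def gamma_sum_half gamma_sum_add gamma_sum_diff flip: H)
  have G_pos: "eval_one G > 0"
    unfolding G_def by (rule eval_one_gamma_sum_pos) (simp_all add: a_def)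
  \<comment> \<open>Because \<open>m \<ge> 1\<close>, the power of \<open>s - t\<close> vanishes at
    \<open>s = t = 1\<close>, leaving the positive value of \<open>G\<close> in both cases.\<close>
  have "eval_one (2 * P) > 0" "eval_one (2 * M) > 0"
    unfolding P M using G_pos m by (simp_all add: power_0_left)
  then have P_nz: "eval_one P \<noteq> 0" and M_nz: "eval_one M \<noteq> 0" by simp_all
  have T: "exc_poly n (signed_perms n) = gamma_sum n a"
    by (simp add: exc_poly_signed_perms_gamma gamma_sum_def a_def)
  have "gamma_positive_biv (DExc n) (real n / 2) \<and> gamma_positive_biv (BDExc n) (real n / 2)"
    if "even n"
  proof -
    have n: "2 * m = n" using that by (simp add: m_def)
    have "DExc n = P" "BDExc n = M"
      by (rule cancel; simp add: double_DExc double_BDExc P M T G_def n)+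
    moreover have "homogeneous n (DExc n)" "homogeneous n (BDExc n)"
      unfolding DExc_def BDExc_def
      by (rule homogeneous_exc_poly; auto simp: even_signed_perms_def)+
    ultimately show ?thesis
      using gamma_positive_bivI[of n] nonneg P_nz M_nz by (simp add: P_def M_def n)
  qed
  moreover have "(\<exists>f g. gamma_positive f \<and> gamma_positive g \<and> DExc_uni n = f + g) \<and>
      (\<exists>f g. gamma_positive f \<and> gamma_positive g \<and> BDExc_uni n = f + g)" if "odd n"
  proof -
    have n: "n = Suc (2 * m)" using that by (simp add: m_def)
    \<comment> \<open>For odd \<open>n\<close> the index range is still \<open>i \<le> m\<close>,
      and each gamma term of degree \<open>n\<close> has a spare factor
      \<open>s + t\<close>.\<close>
    have "gamma_term n i = (var_s + var_t) * gamma_term (2 * m) i" if "i \<le> m" for i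
      using that by (simp add: n gamma_term_def Suc_diff_le mult_ac)
    then have T': "exc_poly n (signed_perms n) = (var_s + var_t) * G"
      unfolding T by (simp add: n gamma_sum_def G_def sum_distrib_left mult_ac)
    have pow: "(var_s - var_t) ^ n = (var_s - var_t) * (var_s - var_t) ^ (2 * m)"
      unfolding n by simp
    \<comment> \<open>Here \<open>2 * P\<close> and \<open>2 * M\<close> play the roles of
      \<open>G + H\<close> and \<open>G - H\<close>.\<close>
    have "2 * (var_s * P + var_t * M) = var_s * (2 * P) + var_t * (2 * M)"
      and "2 * (var_s * M + var_t * P) = var_s * (2 * M) + var_t * (2 * P)"
      by (simp_all add: algebra_simps)
    then have "DExc n = var_s * P + var_t * M" "BDExc n = var_s * M + var_t * P"
      by (rule_tac cancel; simp only: double_DExc double_BDExc T' pow P M; simp add: algebra_simps)+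
    then have "DExc_uni n = [:0, 1:] ^ 0 * poly P 1 + [:0, 1:] ^ 1 * poly M 1"
      and "BDExc_uni n = [:0, 1:] ^ 0 * poly M 1 + [:0, 1:] ^ 1 * poly P 1"
      by (simp_all add: DExc_uni_def BDExc_uni_def var_s_def var_t_def)
    \<comment> \<open>Only \<open>k = 0\<close> and \<open>k = 1\<close> occur. The extra factor
      \<open>t\<close> moves the center of symmetry from \<open>m\<close> to \<open>m + 1\<close>,
      so the two summands have different centers.\<close>
    moreover have "gamma_positive ([:0, 1:] ^ k * poly P 1)" "gamma_positive ([:0, 1:] ^ k * poly M 1)" for k
      unfolding P_def M_def
      by (rule gamma_positive_gamma_sum, rule nonneg, use P_nz M_nz in \<open>simp add: P_def M_def\<close>)+
    ultimately show ?thesis by blast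
  qed
  moreover have "BExc_plus n = DExc n" "BExc_minus n = BDExc n"
    by (rule cancel; simp only: double_BExc_plus double_BExc_minus double_DExc double_BDExc)+
  ultimately show ?thesis by blast
qed

end
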